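(* Let $(B_t)_{t\ge 0}$ be a standard fractional Brownian motion with Hurst parameter $H\in[1/2,1)$, let $\mu\in\mathbb{R}$ and $\sigma>0$, and let $Y_t=\mu t+\sigma B_t$, $t\ge0$, be the fractional Brownian motion with drift $\mu$ and diffusion coefficient $\sigma$. For $t>0$ let $M_t^{H,-}=\sup_{0\le u\le v\le t}(Y_u-Y_v)$. Then $$\lim_{x\to\infty}\frac{1}{x^2}\log P(M_t^{H,-}>x)=-\frac{1}{2\sigma^2t^{2H}}.$$
   Context: A standard fractional Brownian motion $(B_t)_{t\ge0}$ with Hurst parameter $H\in(0,1)$ is a continuous centered Gaussian process with $B_0=0$ and covariance $E[B_tB_s]=\frac12\left(t^{2H}+s^{2H}-|t-s|^{2H}\right)$. *)

theory Defs
  imports "HOL-Probability.Probability"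
begin

text \<open>A point mass counts as a (degenerate) Gaussian law. This is needed for vanishing linear
  combinations, such as those with zero coefficients or those involving only time 0 of a process
  that starts at 0.\<close>

definition gaussian_rv :: "'a measure \<Rightarrow> ('a \<Rightarrow> real) \<Rightarrow> bool" where
  "gaussian_rv M X \<longleftrightarrow> X \<in> borel_measurable M \<and>
     (\<exists>m. (AE \<omega> in M. X \<omega> = m) \<or> (\<exists>s>0. distributed M lborel X (normal_density m s)))"

text \<open>Processes are functions of all reals, but only their values at times \<open>t \<ge> 0\<close> matter.
  Joint Gaussianity of the finite-dimensional distributions is expressed through linear
  combinations.\<close>

definition gaussian_process :: "'a measure \<Rightarrow> (real \<Rightarrow> 'a \<Rightarrow> real) \<Rightarrow> bool" where
  "gaussian_process M X \<longleftrightarrow>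
     (\<forall>I a. finite I \<and> I \<subseteq> {0..} \<longrightarrow> gaussian_rv M (\<lambda>\<omega>. \<Sum>t\<in>I. a t * X t \<omega>))"

text \<open>Continuity and the initial condition are required of every sample path. Since all variables
  involved are Gaussian and hence square integrable, the expectations below are genuine integrals.\<close>

definition standard_fbm :: "'a measure \<Rightarrow> real \<Rightarrow> (real \<Rightarrow> 'a \<Rightarrow> real) \<Rightarrow> bool" where
  "standard_fbm M H B \<longleftrightarrow>
     gaussian_process M B \<and>
     (\<forall>t\<ge>0. prob_space.expectation M (B t) = 0) \<and>
     (\<forall>\<omega>\<in>space M. B 0 \<omega> = 0) \<and>
     (\<forall>\<omega>\<in>space M. continuous_on {0..} (\<lambda>t. B t \<omega>)) \<and>
     (\<forall>t\<ge>0. \<forall>s\<ge>0. prob_space.expectation M (\<lambda>\<omega>. B t \<omega> * B s \<omega>)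
        = (t powr (2 * H) + s powr (2 * H) - \<bar>t - s\<bar> powr (2 * H)) / 2)"

definition fbm_with_drift ::
    "real \<Rightarrow> real \<Rightarrow> (real \<Rightarrow> 'a \<Rightarrow> real) \<Rightarrow> real \<Rightarrow> 'a \<Rightarrow> real" where
  "fbm_with_drift \<mu> \<sigma> B t \<omega> = \<mu> * t + \<sigma> * B t \<omega>"

text \<open>The real supremum is the true one for continuous paths: they are bounded on \<open>{0..t}\<close>, and
  the index set is nonempty for \<open>t \<ge> 0\<close>.\<close>

definition max_drawdown :: "(real \<Rightarrow> 'a \<Rightarrow> real) \<Rightarrow> real \<Rightarrow> 'a \<Rightarrow> real" where
  "max_drawdown Y t \<omega> = (SUP (u, v) \<in> {(u, v). 0 \<le> u \<and> u \<le> v \<and> v \<le> t}. Y u \<omega> - Y v \<omega>)"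

end

theory Submission
  imports Defs "HOL-Real_Asymp.Real_Asymp"
begin

text \<open>The single pair \<open>(u, v) = (0, t)\<close> gives the lower bound, because \<open>B 0 - B t\<close> is normal with
  variance \<open>t powr (2 * H)\<close>. For the upper bound, round \<open>u\<close> and \<open>v\<close> down to the dyadic grid of
  level \<open>m\<close>. The finitely many grid increments have variance at most \<open>t powr (2 * H)\<close>. The
  rounding error is controlled by chaining: allowing the increments of level \<open>k\<close> to be at most
  \<open>x / \<sigma> * (3/4) ^ k\<close>, it costs only \<open>6 * (3/4) ^ m * x\<close>, which is negligible relative
  to \<open>x\<close> as \<open>m\<close> grows. Since \<open>H \<ge> 1/2\<close>, the Gaussian exponent of a violation at level \<open>k\<close>
  exceeds that of the main term by the factor \<open>(9/8) ^ k\<close>, where \<open>9/8 = 2 * (3/4)\<^sup>2\<close>; this beats the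
  \<open>2 ^ k\<close> increments of that level.\<close>

section \<open>Dyadic grids and chaining along a fixed path\<close>

text \<open>For \<open>t > 0\<close> and \<open>s >= 0\<close>, the point
  \<open>t * real (dyadic_index t n s) / 2 ^ n\<close> is the last multiple of the mesh
  \<open>t / 2 ^ n\<close> at or before \<open>s\<close>. Rounding down preserves order and makes
  successive levels fit together.\<close>

definition dyadic_index :: "real \<Rightarrow> nat \<Rightarrow> real \<Rightarrow> nat" where
  "dyadic_index t n s = nat \<lfloor>s / t * 2 ^ n\<rfloor>"

lemma dyadic_index_le:
  assumes "t > 0" "s \<le> t"
  shows "dyadic_index t n s \<le> 2 ^ n"
proof -
  have "\<lfloor>s / t * 2 ^ n\<rfloor> \<le> \<lfloor>2 ^ n :: real\<rfloor>"
    using mult_right_mono[of "s / t" 1 "2 ^ n"] assms by (intro floor_mono) simp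
  then show ?thesis
    unfolding dyadic_index_def by (simp add: nat_le_iff)
qed

lemma dyadic_index_mono:
  assumes "t > 0" "u \<le> v"
  shows "dyadic_index t n u \<le> dyadic_index t n v"
  unfolding dyadic_index_def using assms
  by (intro nat_mono floor_mono mult_right_mono divide_right_mono) auto

lemma real_dyadic_index:
  assumes "t > 0" "0 \<le> s"
  shows "real (dyadic_index t n s) = of_int \<lfloor>s / t * 2 ^ n\<rfloor>"
proof -
  have "0 \<le> s / t * 2 ^ n" using assms by simp
  then show ?thesis unfolding dyadic_index_def by (simp del: times_divide_eq_left)
qed

lemma dyadic_point_in:
  assumes "t > 0" "i \<le> 2 ^ n"
  shows "t * real i / 2 ^ n \<in> {0..t}"
proof -
  have "real i \<le> 2 ^ n"
    using of_nat_mono[OF assms(2), where 'a = real] by simp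
  then have "t * real i / 2 ^ n \<le> t * 2 ^ n / 2 ^ n"
    using \<open>t > 0\<close> by (intro divide_right_mono mult_left_mono) auto
  then show ?thesis
    using \<open>t > 0\<close> by simp
qed

lemma dyadic_index_tendsto:
  assumes "t > 0" "0 \<le> s"
  shows "(\<lambda>n. t * real (dyadic_index t n s) / 2 ^ n) \<longlonglongrightarrow> s"
proof (rule tendsto_sandwich)
  have "s - t / 2 ^ n \<le> t * real (dyadic_index t n s) / 2 ^ n" for n
  proof -
    have "t * (s / t * 2 ^ n - 1) / 2 ^ n \<le> t * real (dyadic_index t n s) / 2 ^ n"
      unfolding real_dyadic_index[OF assms] using \<open>t > 0\<close>
      by (intro divide_right_mono mult_left_mono) (linarith | simp)+
    then show ?thesis
      using \<open>t > 0\<close> by (simp add: right_diff_distrib diff_divide_distrib)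
  qed
  then show "\<forall>\<^sub>F n in sequentially. s - t / 2 ^ n \<le> t * real (dyadic_index t n s) / 2 ^ n" by simp
  have "t * real (dyadic_index t n s) / 2 ^ n \<le> t * (s / t * 2 ^ n) / 2 ^ n" for n
    unfolding real_dyadic_index[OF assms] using \<open>t > 0\<close>
    by (intro divide_right_mono mult_left_mono) (linarith | simp)+
  then show "\<forall>\<^sub>F n in sequentially. t * real (dyadic_index t n s) / 2 ^ n \<le> s"
    using \<open>t > 0\<close> by simp
  show "(\<lambda>n. s - t / 2 ^ n) \<longlonglongrightarrow> s" by real_asymp
qed simp

text \<open>Doubling a real number with floor \<open>f\<close> gives floor \<open>2 * f\<close> or
  \<open>2 * f + 1\<close>. Hence passing to the next level leaves the approximating point fixed or
  moves it right by one cell of the finer grid.\<close>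

lemma dyadic_index_Suc:
  assumes "t > 0" "0 \<le> s"
  shows "dyadic_index t (Suc n) s = 2 * dyadic_index t n s
    \<or> dyadic_index t (Suc n) s = Suc (2 * dyadic_index t n s)"
proof -
  have "\<lfloor>2 * (s / t * 2 ^ n)\<rfloor> = 2 * \<lfloor>s / t * 2 ^ n\<rfloor> \<or> \<lfloor>2 * (s / t * 2 ^ n)\<rfloor> = 2 * \<lfloor>s / t * 2 ^ n\<rfloor> + 1"
    by linarith
  moreover have "s / t * 2 ^ Suc n = 2 * (s / t * 2 ^ n)"
    by simp
  ultimately have "\<lfloor>s / t * 2 ^ Suc n\<rfloor> = 2 * \<lfloor>s / t * 2 ^ n\<rfloor> \<or> \<lfloor>s / t * 2 ^ Suc n\<rfloor> = 2 * \<lfloor>s / t * 2 ^ n\<rfloor> + 1"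
    by (simp only:)
  then have "real (dyadic_index t (Suc n) s) = 2 * real (dyadic_index t n s)
      \<or> real (dyadic_index t (Suc n) s) = 2 * real (dyadic_index t n s) + 1"
    unfolding real_dyadic_index[OF assms] by linarith
  then show ?thesis by linarith
qed

text \<open>Telescope along the roundings of \<open>s\<close>, which converge to \<open>s\<close>.
  Each step is zero or a single grid increment of the next level, and the bounds at the levels above
  \<open>m\<close> sum to \<open>3 * c * (3/4) ^ m\<close>. Continuity carries the estimate to the
  limit.\<close>

lemma dyadic_chaining:
  fixes f :: "real \<Rightarrow> real"
  assumes cont: "continuous_on {0..t} f" and "t > 0"
    and incr: "\<And>k j. k > m \<Longrightarrow> j < 2 ^ k \<Longrightarrow>
      \<bar>f (t * real (Suc j) / 2 ^ k) - f (t * real j / 2 ^ k)\<bar> \<le> c * (3/4) ^ k"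
    and s: "s \<in> {0..t}"
  shows "\<exists>i\<le>2 ^ m. \<bar>f s - f (t * real i / 2 ^ m)\<bar> \<le> 3 * c * (3/4) ^ m"
proof -
  define i where "i k = dyadic_index t k s" for k
  define p where "p k = t * real (i k) / 2 ^ k" for k
  have i_le: "i k \<le> 2 ^ k" for k
    unfolding i_def using s \<open>t > 0\<close> by (intro dyadic_index_le) auto
  have p_in: "p k \<in> {0..t}" for k
    unfolding p_def using \<open>t > 0\<close> i_le by (rule dyadic_point_in)
  have p_lim: "p \<longlonglongrightarrow> s"
    unfolding p_def i_def using s \<open>t > 0\<close> by (intro dyadic_index_tendsto) auto
  have step: "\<bar>f (p (Suc k)) - f (p k)\<bar> \<le> c * (3/4) ^ Suc k" if "k \<ge> m" for k
  proof -
    have "i (Suc k) = 2 * i k \<or> i (Suc k) = Suc (2 * i k)"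
      unfolding i_def using s \<open>t > 0\<close> by (intro dyadic_index_Suc) auto
    then show ?thesis
    proof
      assume "i (Suc k) = 2 * i k"
      then have "p (Suc k) = p k" by (simp add: p_def)
      \<comment> \<open>It bounds an absolute value, namely that of the increment at
        \<open>j = 0\<close>.\<close>
      moreover have "0 \<le> c * (3/4) ^ Suc k"
        using incr[of "Suc k" 0] that by (intro order.trans[OF abs_ge_zero]) auto
      ultimately show ?thesis by simp
    next
      assume odd: "i (Suc k) = Suc (2 * i k)"
      have "p k = t * real (2 * i k) / 2 ^ Suc k" by (simp add: p_def)
      \<comment> \<open>The odd index \<open>2 * i k + 1\<close> is itself at most
        \<open>2 ^ Suc k\<close>, so \<open>2 * i k\<close> is the left end of a cell inside the
        interval.\<close>
      moreover have "2 * i k < 2 ^ Suc k"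
        using odd i_le[of "Suc k"] by simp
      ultimately show ?thesis
        using incr[of "Suc k" "2 * i k"] that unfolding p_def[of "Suc k"] odd by simp
    qed
  qed
  \<comment> \<open>The right-hand side is the exact geometric sum over the levels from
    \<open>m + 1\<close> to \<open>m + n\<close>; keeping the subtracted term lets the induction
    close.\<close>
  have partial: "\<bar>f (p (m + n)) - f (p m)\<bar> \<le> 3 * c * ((3/4) ^ m - (3/4) ^ (m + n))" for n
  proof (induction n)
    case (Suc n)
    define q where "q = c * (3/4) ^ (m + n)"
    have "\<bar>f (p (Suc (m + n))) - f (p (m + n))\<bar> \<le> 3/4 * q"
      using step[of "m + n"] by (simp add: q_def)
    moreover have "\<bar>f (p (m + n)) - f (p m)\<bar> \<le> 3 * c * (3/4) ^ m - 3 * q"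
      using Suc.IH by (simp add: q_def right_diff_distrib)
    moreover have "3 * c * ((3/4) ^ m - (3/4) ^ (m + Suc n)) = 3 * c * (3/4) ^ m - 9/4 * q"
      by (simp add: q_def right_diff_distrib)
    ultimately show ?case
      unfolding add_Suc_right by linarith
  qed simp
  have "c \<ge> 0"
  proof -
    have "0 \<le> c * (3/4) ^ Suc m"
      using incr[of "Suc m" 0] by (intro order.trans[OF abs_ge_zero]) auto
    then have "0 \<le> c * (3/4) ^ Suc m / (3/4) ^ Suc m"
      by (intro divide_nonneg_pos) simp_all
    then show ?thesis by simp
  qed
  have bound: "\<bar>f (p (m + n)) - f (p m)\<bar> \<le> 3 * c * (3/4) ^ m" for n
  proof -
    have "3 * c * ((3/4) ^ m - (3/4) ^ (m + n)) \<le> 3 * c * (3/4) ^ m"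
      using \<open>c \<ge> 0\<close> by (intro mult_left_mono) auto
    with partial[of n] show ?thesis by linarith
  qed
  have "(\<lambda>k. f (p k)) \<longlonglongrightarrow> f s"
    by (rule continuous_on_tendsto_compose[OF cont p_lim s]) (use p_in in simp)
  then have "(\<lambda>n. f (p (m + n))) \<longlonglongrightarrow> f s"
    by (subst add.commute) (rule LIMSEQ_ignore_initial_segment)
  then have "(\<lambda>n. \<bar>f (p (m + n)) - f (p m)\<bar>) \<longlonglongrightarrow> \<bar>f s - f (p m)\<bar>"
    by (intro tendsto_intros)
  then have "\<bar>f s - f (p m)\<bar> \<le> 3 * c * (3/4) ^ m"
    by (rule LIMSEQ_le_const2) (use bound in simp)
  then show ?thesis
    using i_le[of m] unfolding p_def by blast
qed

section \<open>The drawdown event in terms of pairs of times\<close>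

text \<open>A continuous path is bounded on the compact interval, so the supremum is over a nonempty
  set bounded above and exceeds \<open>x\<close> exactly when one of its elements does.\<close>

lemma max_drawdown_gt_iff:
  assumes cont: "continuous_on {0..t} (\<lambda>s. Y s \<omega>)" and "t \<ge> 0"
  shows "max_drawdown Y t \<omega> > x \<longleftrightarrow> (\<exists>u v. 0 \<le> u \<and> u \<le> v \<and> v \<le> t \<and> Y u \<omega> - Y v \<omega> > x)"
proof -
  let ?I = "{(u, v). 0 \<le> u \<and> u \<le> v \<and> v \<le> t}"
  have "bounded ((\<lambda>s. Y s \<omega>) ` {0..t})"
    by (intro compact_imp_bounded compact_continuous_image cont) simp
  then obtain K where K: "\<forall>s\<in>{0..t}. \<bar>Y s \<omega>\<bar> \<le> K"
    unfolding bounded_iff by auto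
  have "bdd_above ((\<lambda>(u, v). Y u \<omega> - Y v \<omega>) ` ?I)"
  proof (rule bdd_aboveI2)
    fix uv assume "uv \<in> ?I"
    then show "(case uv of (u, v) \<Rightarrow> Y u \<omega> - Y v \<omega>) \<le> 2 * K"
      using bspec[OF K, of "fst uv"] bspec[OF K, of "snd uv"] by (auto split: prod.splits)
  qed
  moreover have "(0, 0) \<in> ?I" using \<open>t \<ge> 0\<close> by simp
  ultimately show ?thesis
    unfolding max_drawdown_def by (subst less_cSUP_iff) auto
qed

text \<open>A strict inequality at \<open>(u, v)\<close> survives at nearby grid points by
  continuity, and rounding down keeps the two times in order. The point is to have only countably
  many pairs, which gives measurability.\<close>

lemma max_drawdown_gt_iff_dyadic:
  assumes cont: "continuous_on {0..t} (\<lambda>s. Y s \<omega>)" and "t > 0"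
  shows "max_drawdown Y t \<omega> > x \<longleftrightarrow> (\<exists>n i j. i \<le> j \<and> j \<le> 2 ^ n \<and>
    Y (t * real i / 2 ^ n) \<omega> - Y (t * real j / 2 ^ n) \<omega> > x)" (is "_ \<longleftrightarrow> ?dyadic")
proof
  assume "max_drawdown Y t \<omega> > x"
  then obtain u v where uv: "0 \<le> u" "u \<le> v" "v \<le> t" and gt: "Y u \<omega> - Y v \<omega> > x"
    using max_drawdown_gt_iff[of t Y \<omega> x] cont \<open>t > 0\<close> by (meson less_eq_real_def)
  let ?p = "\<lambda>s n. t * real (dyadic_index t n s) / 2 ^ n"
  have lim: "(\<lambda>n. Y (?p s n) \<omega>) \<longlonglongrightarrow> Y s \<omega>" if "0 \<le> s" "s \<le> t" for s
    using that \<open>t > 0\<close>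
    by (intro continuous_on_tendsto_compose[OF cont dyadic_index_tendsto])
      (use dyadic_point_in[OF _ dyadic_index_le] in auto)
  have "(\<lambda>n. Y (?p u n) \<omega> - Y (?p v n) \<omega>) \<longlonglongrightarrow> Y u \<omega> - Y v \<omega>"
    using uv by (intro tendsto_diff lim) auto
  from order_tendstoD(1)[OF this gt] obtain n where "x < Y (?p u n) \<omega> - Y (?p v n) \<omega>"
    by (auto simp: eventually_sequentially)
  then show ?dyadic
    using dyadic_index_mono[OF \<open>t > 0\<close> uv(2)] dyadic_index_le[OF \<open>t > 0\<close> uv(3)] by blast
next
  assume ?dyadic
  then obtain n i j where ij: "i \<le> j" "j \<le> 2 ^ n"
    and gt: "Y (t * real i / 2 ^ n) \<omega> - Y (t * real j / 2 ^ n) \<omega> > x" by blast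
  have "0 \<le> t * real i / 2 ^ n" "t * real i / 2 ^ n \<le> t * real j / 2 ^ n"
    using ij \<open>t > 0\<close> by (auto intro!: divide_right_mono mult_left_mono)
  moreover have "t * real j / 2 ^ n \<le> t"
    using dyadic_point_in[OF \<open>t > 0\<close> ij(2)] by simp
  ultimately show "max_drawdown Y t \<omega> > x"
    using max_drawdown_gt_iff[of t Y \<omega> x] cont gt \<open>t > 0\<close> by (meson less_eq_real_def)
qed

section \<open>Gaussian tails and moments\<close>

context prob_space
begin

text \<open>For \<open>y > a >= 0\<close> one has \<open>y^2 >= (y - a)^2 + a^2\<close>, so beyond
  \<open>a\<close> the density is at most the claimed exponential times the normal density centered
  at \<open>a\<close>, whose total mass is 1.\<close>

lemma normal_tail_le:
  assumes D: "distributed M lborel X (normal_density 0 s)" and "s > 0" "a \<ge> 0"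
  shows "prob {\<omega> \<in> space M. X \<omega> > a} \<le> exp (- a\<^sup>2 / (2 * s\<^sup>2))"
proof -
  have le: "normal_density 0 s y \<le> exp (- a\<^sup>2 / (2 * s\<^sup>2)) * normal_density a s y" if "y > a" for y
  proof -
    have "(y - a)\<^sup>2 + a\<^sup>2 \<le> y\<^sup>2"
      using that \<open>a \<ge> 0\<close> by (simp add: power2_eq_square algebra_simps mult_left_mono)
    then have "- y\<^sup>2 / (2 * s\<^sup>2) \<le> - a\<^sup>2 / (2 * s\<^sup>2) + - (y - a)\<^sup>2 / (2 * s\<^sup>2)"
      unfolding add_divide_distrib[symmetric] by (intro divide_right_mono) auto
    then have "exp (- y\<^sup>2 / (2 * s\<^sup>2)) \<le> exp (- a\<^sup>2 / (2 * s\<^sup>2)) * exp (- (y - a)\<^sup>2 / (2 * s\<^sup>2))"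
      unfolding exp_add[symmetric] by simp
    then show ?thesis
      unfolding normal_density_def by (simp add: divide_right_mono)
  qed
  have "emeasure M {\<omega> \<in> space M. X \<omega> > a} = emeasure M (X -` {a<..} \<inter> space M)"
    by (rule arg_cong[where f = "emeasure M"]) auto
  also have "\<dots> = (\<integral>\<^sup>+y. ennreal (normal_density 0 s y) * indicator {a<..} y \<partial>lborel)"
    by (rule distributed_emeasure[OF D]) simp
  also have "\<dots> \<le> (\<integral>\<^sup>+y. ennreal (exp (- a\<^sup>2 / (2 * s\<^sup>2)) * normal_density a s y) \<partial>lborel)"
    using le by (intro nn_integral_mono) (auto simp: indicator_def ennreal_leI)
  also have "\<dots> = ennreal (exp (- a\<^sup>2 / (2 * s\<^sup>2)))"
    using \<open>s > 0\<close> by (subst nn_integral_eq_integral) auto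
  finally show ?thesis
    by (simp add: emeasure_eq_measure)
qed

text \<open>The density decreases on the nonnegative half-line, so the mass of the unit interval
  from \<open>a\<close> to \<open>a + 1\<close> is at least the value at its right end. The shift by
  1 does not affect the leading order of the exponent.\<close>

lemma normal_tail_ge:
  assumes D: "distributed M lborel X (normal_density 0 s)" and "s > 0" "a \<ge> 0"
  shows "prob {\<omega> \<in> space M. X \<omega> > a} \<ge> normal_density 0 s (a + 1)"
proof -
  have le: "normal_density 0 s (a + 1) \<le> normal_density 0 s y" if "y \<in> {a<..a+1}" for y
  proof -
    have "y\<^sup>2 \<le> (a + 1)\<^sup>2"
      using that \<open>a \<ge> 0\<close> by (intro power_mono) auto
    then have "- (a + 1)\<^sup>2 / (2 * s\<^sup>2) \<le> - y\<^sup>2 / (2 * s\<^sup>2)"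
      by (intro divide_right_mono) auto
    then show ?thesis
      unfolding normal_density_def by (simp add: divide_right_mono)
  qed
  have "ennreal (normal_density 0 s (a + 1)) = (\<integral>\<^sup>+y. ennreal (normal_density 0 s (a + 1)) * indicator {a<..a+1} y \<partial>lborel)"
    by (subst nn_integral_cmult_indicator) auto
  also have "\<dots> \<le> (\<integral>\<^sup>+y. ennreal (normal_density 0 s y) * indicator {a<..} y \<partial>lborel)"
    using le by (intro nn_integral_mono) (auto simp: indicator_def ennreal_leI)
  also have "\<dots> = emeasure M (X -` {a<..} \<inter> space M)"
    by (rule distributed_emeasure[OF D, symmetric]) simp
  also have "\<dots> = emeasure M {\<omega> \<in> space M. X \<omega> > a}"
    by (rule arg_cong[where f = "emeasure M"]) auto
  finally show ?thesis
    by (simp add: emeasure_eq_measure)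
qed

lemma gaussian_rv_square_integrable:
  assumes "gaussian_rv M X"
  shows "integrable M (\<lambda>\<omega>. (X \<omega>)\<^sup>2)"
proof -
  have X[measurable]: "X \<in> borel_measurable M"
    using assms by (simp add: gaussian_rv_def)
  consider m where "AE \<omega> in M. X \<omega> = m"
    | m s where "s > 0" "distributed M lborel X (normal_density m s)"
    using assms unfolding gaussian_rv_def by blast
  then show ?thesis
  proof cases
    case 1
    then have "AE \<omega> in M. (X \<omega>)\<^sup>2 = m\<^sup>2" by auto
    then have "integrable M (\<lambda>\<omega>. (X \<omega>)\<^sup>2) \<longleftrightarrow> integrable M (\<lambda>\<omega>. m\<^sup>2)"
      by (intro integrable_cong_AE) auto
    then show ?thesis by simp
  next
    case 2
    \<comment> \<open>Expanding \<open>x^2\<close> as \<open>(x - m)^2 + 2 * m * x - m^2\<close>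
      reduces the claim to the central second moment, the first moment and the density
      itself.\<close>
    have "(\<lambda>x. normal_density m s x * x\<^sup>2) = (\<lambda>x. normal_density m s x * (x - m)\<^sup>2
        + 2 * m * (normal_density m s x * x) - m\<^sup>2 * normal_density m s x)"
      by (auto simp: fun_eq_iff power2_eq_square algebra_simps)
    then have "integrable lborel (\<lambda>x. normal_density m s x * x\<^sup>2)"
      using 2(1) by (simp only:) (intro Bochner_Integration.integrable_add Bochner_Integration.integrable_diff
          integrable_mult_right integrable_normal_moment integrable_normal_moment_nz_1 integrable_normal_density)
    then show ?thesis
      using distributed_integrable[OF 2(2), of "\<lambda>x. x\<^sup>2"] by simp
  qed
qed

text \<open>Mean and variance determine a Gaussian law. The degenerate alternative would have second
  moment 0, contrary to \<open>s > 0\<close>.\<close>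

lemma centered_gaussian_distributed:
  assumes "gaussian_rv M X" "expectation X = 0" "expectation (\<lambda>\<omega>. (X \<omega>)\<^sup>2) = s\<^sup>2" "s > 0"
  shows "distributed M lborel X (normal_density 0 s)"
proof -
  have X[measurable]: "X \<in> borel_measurable M"
    using assms by (simp add: gaussian_rv_def)
  consider m where "AE \<omega> in M. X \<omega> = m"
    | m s' where "s' > 0" "distributed M lborel X (normal_density m s')"
    using assms unfolding gaussian_rv_def by blast
  then show ?thesis
  proof cases
    case 1
    then have "expectation X = expectation (\<lambda>\<omega>. m)"
      by (intro integral_cong_AE) auto
    then have "m = 0" using assms(2) by (simp add: prob_space)
    then have "AE \<omega> in M. (X \<omega>)\<^sup>2 = 0" using 1 by auto
    then have "expectation (\<lambda>\<omega>. (X \<omega>)\<^sup>2) = expectation (\<lambda>\<omega>. 0)"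
      by (intro integral_cong_AE) auto
    then show ?thesis using assms by simp
  next
    case 2
    have "m = 0" using normal_distributed_expectation[OF 2] assms(2) by simp
    moreover have "s'\<^sup>2 = s\<^sup>2"
      using normal_distributed_variance[OF 2] assms(2,3) by simp
    then have "s' = s" using 2(1) assms(4) by simp
    ultimately show ?thesis using 2 by simp
  qed
qed

end

section \<open>Increments of fractional Brownian motion\<close>

locale fbm = prob_space +
  fixes B :: "real \<Rightarrow> 'a \<Rightarrow> real" and H :: real
  assumes fbm: "standard_fbm M H B" and H: "1/2 \<le> H"
begin

lemma B_gaussian: "u \<ge> 0 \<Longrightarrow> gaussian_rv M (B u)"
proof -
  assume "u \<ge> 0"
  have "gaussian_process M B" using fbm by (simp add: standard_fbm_def)
  then have "gaussian_rv M (\<lambda>\<omega>. \<Sum>t\<in>{u}. 1 * B t \<omega>)"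
    unfolding gaussian_process_def using \<open>u \<ge> 0\<close>
    by (elim allE[of _ "{u}"] allE[of _ "\<lambda>_. 1"]) auto
  then show ?thesis by simp
qed

lemma B_measurable: "u \<ge> 0 \<Longrightarrow> B u \<in> borel_measurable M"
  using B_gaussian by (simp add: gaussian_rv_def)

lemma B_continuous: "\<omega> \<in> space M \<Longrightarrow> continuous_on {0..t} (\<lambda>s. B s \<omega>)"
  using fbm unfolding standard_fbm_def by (auto intro: continuous_on_subset)

lemma drift_continuous:
  "\<omega> \<in> space M \<Longrightarrow> continuous_on {0..t} (\<lambda>s. fbm_with_drift \<mu> \<sigma> B s \<omega>)"
  unfolding fbm_with_drift_def by (intro continuous_intros B_continuous)

text \<open>This is the linear combination with coefficients 1 and -1. For \<open>u = v\<close> the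
  index set would collapse to one point and the sum would be \<open>B u\<close>.\<close>

lemma diff_gaussian:
  assumes "u \<ge> 0" "v \<ge> 0" "u \<noteq> v"
  shows "gaussian_rv M (\<lambda>\<omega>. B u \<omega> - B v \<omega>)"
proof -
  have "gaussian_process M B" using fbm by (simp add: standard_fbm_def)
  then have "gaussian_rv M (\<lambda>\<omega>. \<Sum>t\<in>{u, v}. (if t = u then 1 else - 1) * B t \<omega>)"
    unfolding gaussian_process_def using assms
    by (elim allE[of _ "{u, v}"] allE[of _ "\<lambda>t. if t = u then 1 else - 1"]) auto
  then show ?thesis using assms by simp
qed

text \<open>Expanding the square and inserting the covariance cancels all terms but
  \<open>\<bar>u - v\<bar> powr (2 * H)\<close>. The parameter of \<open>normal_density\<close> is
  the standard deviation, hence the exponent \<open>H\<close>.\<close>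

lemma increment_distributed:
  assumes uv: "u \<ge> 0" "v \<ge> 0" "u \<noteq> v"
  shows "distributed M lborel (\<lambda>\<omega>. B u \<omega> - B v \<omega>) (normal_density 0 (\<bar>u - v\<bar> powr H))"
proof (rule centered_gaussian_distributed[OF diff_gaussian[OF uv]])
  note [measurable] = B_measurable[OF uv(1)] B_measurable[OF uv(2)]
  have sq: "integrable M (\<lambda>\<omega>. (B u \<omega>)\<^sup>2)" "integrable M (\<lambda>\<omega>. (B v \<omega>)\<^sup>2)"
    using uv by (auto intro: gaussian_rv_square_integrable B_gaussian)
  then have int: "integrable M (B u)" "integrable M (B v)"
    by (auto intro: square_integrable_imp_integrable)
  show "expectation (\<lambda>\<omega>. B u \<omega> - B v \<omega>) = 0"
    using fbm uv int by (simp add: standard_fbm_def)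
  have pr: "integrable M (\<lambda>\<omega>. B u \<omega> * B v \<omega>)"
  proof (rule Bochner_Integration.integrable_bound[OF Bochner_Integration.integrable_add[OF sq]])
    have "\<bar>x * y\<bar> \<le> x\<^sup>2 + y\<^sup>2" for x y :: real
      using zero_le_power2[of "\<bar>x\<bar> - \<bar>y\<bar>"] abs_ge_zero[of "x * y"]
      unfolding power2_diff power2_abs abs_mult by linarith
    then show "AE \<omega> in M. norm (B u \<omega> * B v \<omega>) \<le> norm ((B u \<omega>)\<^sup>2 + (B v \<omega>)\<^sup>2)"
      by simp
  qed simp
  have cov: "expectation (\<lambda>\<omega>. B t \<omega> * B s \<omega>)
      = (t powr (2 * H) + s powr (2 * H) - \<bar>t - s\<bar> powr (2 * H)) / 2" if "t \<ge> 0" "s \<ge> 0" for t s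
    using fbm that by (simp add: standard_fbm_def)
  have "expectation (\<lambda>\<omega>. (B u \<omega> - B v \<omega>)\<^sup>2)
      = expectation (\<lambda>\<omega>. (B u \<omega>)\<^sup>2 + (B v \<omega>)\<^sup>2 - 2 * (B u \<omega> * B v \<omega>))"
    by (simp add: power2_diff algebra_simps)
  also have "\<dots> = expectation (\<lambda>\<omega>. B u \<omega> * B u \<omega>) + expectation (\<lambda>\<omega>. B v \<omega> * B v \<omega>)
      - 2 * expectation (\<lambda>\<omega>. B u \<omega> * B v \<omega>)"
    using sq pr by (simp add: power2_eq_square)
  \<comment> \<open>On the diagonal the covariance is \<open>u powr (2 * H)\<close>, because
    \<open>0 powr (2 * H)\<close> is 0.\<close>
  also have "\<dots> = \<bar>u - v\<bar> powr (2 * H)"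
    unfolding cov[OF uv(1) uv(1)] cov[OF uv(2) uv(2)] cov[OF uv(1,2)]
    by (simp add: add_divide_distrib diff_divide_distrib)
  also have "\<dots> = (\<bar>u - v\<bar> powr H)\<^sup>2"
    by (simp add: power2_eq_square flip: powr_add)
  finally show "expectation (\<lambda>\<omega>. (B u \<omega> - B v \<omega>)\<^sup>2) = (\<bar>u - v\<bar> powr H)\<^sup>2" .
  show "\<bar>u - v\<bar> powr H > 0" using uv by simp
qed

lemma increment_tail_le:
  assumes uv: "u \<ge> 0" "v \<ge> 0" "\<bar>u - v\<bar> \<le> d" and "a \<ge> 0"
  shows "prob {\<omega> \<in> space M. B u \<omega> - B v \<omega> > a} \<le> exp (- a\<^sup>2 / (2 * d powr (2 * H)))"
proof (cases "u = v")
  \<comment> \<open>The event is empty here, since \<open>a >= 0\<close>.\<close>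
  case True
  then show ?thesis using \<open>a \<ge> 0\<close> by simp
next
  case False
  have sq: "(\<bar>u - v\<bar> powr H)\<^sup>2 = \<bar>u - v\<bar> powr (2 * H)"
    by (simp add: power2_eq_square flip: powr_add)
  have "prob {\<omega> \<in> space M. B u \<omega> - B v \<omega> > a} \<le> exp (- a\<^sup>2 / (2 * (\<bar>u - v\<bar> powr H)\<^sup>2))"
    using False uv \<open>a \<ge> 0\<close> by (intro normal_tail_le increment_distributed) auto
  also have "\<dots> \<le> exp (- a\<^sup>2 / (2 * d powr (2 * H)))"
    unfolding sq using uv H False
    by (simp add: divide_left_mono powr_mono2 zero_less_mult_iff)
  finally show ?thesis .
qed

lemma abs_increment_tail_le:
  assumes uv: "u \<ge> 0" "v \<ge> 0" "\<bar>u - v\<bar> \<le> d" and "a \<ge> 0"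
  shows "prob {\<omega> \<in> space M. \<bar>B u \<omega> - B v \<omega>\<bar> > a} \<le> 2 * exp (- a\<^sup>2 / (2 * d powr (2 * H)))"
proof -
  note [measurable] = B_measurable[OF uv(1)] B_measurable[OF uv(2)]
  have "{\<omega> \<in> space M. \<bar>B u \<omega> - B v \<omega>\<bar> > a}
      = {\<omega> \<in> space M. B u \<omega> - B v \<omega> > a} \<union> {\<omega> \<in> space M. B v \<omega> - B u \<omega> > a}"
    by auto
  then have "prob {\<omega> \<in> space M. \<bar>B u \<omega> - B v \<omega>\<bar> > a}
      \<le> prob {\<omega> \<in> space M. B u \<omega> - B v \<omega> > a} + prob {\<omega> \<in> space M. B v \<omega> - B u \<omega> > a}"
    by (simp add: measure_Un_le)
  also have "\<dots> \<le> 2 * exp (- a\<^sup>2 / (2 * d powr (2 * H)))"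
    using increment_tail_le[OF uv \<open>a \<ge> 0\<close>] increment_tail_le[OF uv(2,1) _ \<open>a \<ge> 0\<close>, of d] uv(3)
    by linarith
  finally show ?thesis .
qed

section \<open>Tail bounds for the drawdown\<close>

text \<open>The supremum runs over uncountably many pairs; the dyadic description turns the event
  into a countable union. The lower bound needs this for monotonicity of
  \<open>prob\<close>.\<close>

lemma drawdown_measurable:
  assumes "t > 0"
  shows "{\<omega> \<in> space M. max_drawdown (fbm_with_drift \<mu> \<sigma> B) t \<omega> > x} \<in> events"
proof -
  let ?Y = "fbm_with_drift \<mu> \<sigma> B"
  have [measurable]: "B (t * real i / 2 ^ n) \<in> borel_measurable M" for i n
    using \<open>t > 0\<close> by (intro B_measurable) simp
  have [measurable]: "?Y (t * real i / 2 ^ n) \<in> borel_measurable M" for i n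
    unfolding fbm_with_drift_def by measurable
  have "{\<omega> \<in> space M. max_drawdown ?Y t \<omega> > x} = {\<omega> \<in> space M. \<exists>n i j. i \<le> j \<and> j \<le> 2 ^ n \<and>
      ?Y (t * real i / 2 ^ n) \<omega> - ?Y (t * real j / 2 ^ n) \<omega> > x}"
    using max_drawdown_gt_iff_dyadic[of t ?Y _ x] drift_continuous \<open>t > 0\<close> by blast
  also have "\<dots> \<in> events"
    by measurable
  finally show ?thesis .
qed

text \<open>The pair \<open>(0, t)\<close> gives a drawdown above \<open>x\<close> as soon as
  \<open>B 0 - B t\<close> exceeds \<open>(x + \<mu> * t) / \<sigma>\<close>; the drift shifts the
  threshold, and the added 1 comes from \<open>normal_tail_ge\<close>.\<close>

lemma drawdown_tail_ge:
  assumes "t > 0" "\<sigma> > 0" "x + \<mu> * t \<ge> 0"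
  shows "prob {\<omega> \<in> space M. max_drawdown (fbm_with_drift \<mu> \<sigma> B) t \<omega> > x}
    \<ge> normal_density 0 (t powr H) ((x + \<mu> * t) / \<sigma> + 1)"
proof -
  have "distributed M lborel (\<lambda>\<omega>. B 0 \<omega> - B t \<omega>) (normal_density 0 (t powr H))"
    using increment_distributed[of 0 t] \<open>t > 0\<close> by simp
  then have "normal_density 0 (t powr H) ((x + \<mu> * t) / \<sigma> + 1)
      \<le> prob {\<omega> \<in> space M. B 0 \<omega> - B t \<omega> > (x + \<mu> * t) / \<sigma>}"
    using assms by (intro normal_tail_ge) auto
  also have "\<dots> \<le> prob {\<omega> \<in> space M. max_drawdown (fbm_with_drift \<mu> \<sigma> B) t \<omega> > x}"
  proof (intro finite_measure_mono drawdown_measurable \<open>t > 0\<close> subsetI CollectI conjI)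
    fix \<omega> assume "\<omega> \<in> {\<omega> \<in> space M. B 0 \<omega> - B t \<omega> > (x + \<mu> * t) / \<sigma>}"
    then have \<omega>: "\<omega> \<in> space M" "B 0 \<omega> - B t \<omega> > (x + \<mu> * t) / \<sigma>" by auto
    show "\<omega> \<in> space M" by fact
    have "x < fbm_with_drift \<mu> \<sigma> B 0 \<omega> - fbm_with_drift \<mu> \<sigma> B t \<omega>"
      using \<omega>(2) \<open>\<sigma> > 0\<close> by (simp add: fbm_with_drift_def field_simps)
    then show "max_drawdown (fbm_with_drift \<mu> \<sigma> B) t \<omega> > x"
      using max_drawdown_gt_iff[of t "fbm_with_drift \<mu> \<sigma> B" \<omega> x] drift_continuous[OF \<omega>(1)] \<open>t > 0\<close>
      by (meson less_eq_real_def)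
  qed
  finally show ?thesis .
qed

text \<open>Here \<open>w\<close> is the Gaussian exponent for an increment over the full length
  \<open>t\<close> to exceed \<open>z\<close>. At level \<open>k\<close> the exponent is at least
  \<open>w * (9/8) ^ k\<close>, which pays for the union over \<open>2 ^ k\<close> cells and leaves
  a bound summable in \<open>k\<close>.\<close>

lemma level_tail_le:
  assumes "t > 0" "z \<ge> 0" and large: "w \<ge> 8 * ln 4" and w: "w = z\<^sup>2 / (2 * t powr (2 * H))"
  shows "prob (\<Union>j<2^k. {\<omega> \<in> space M.
      \<bar>B (t * real (Suc j) / 2 ^ k) \<omega> - B (t * real j / 2 ^ k) \<omega>\<bar> > z * (3/4) ^ k})
    \<le> 2 * exp (- w) * (1/2) ^ k" (is "prob (\<Union>j<2^k. ?E j) \<le> _")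
proof -
  define h where "h = t / 2 ^ k"
  have h: "h > 0" using \<open>t > 0\<close> by (simp add: h_def)
  have E_le: "prob (?E j) \<le> 2 * exp (- (w * (1 + real k / 8)))" for j
  proof -
    have "prob (?E j) \<le> 2 * exp (- (z * (3/4) ^ k)\<^sup>2 / (2 * h powr (2 * H)))"
    proof (rule abs_increment_tail_le)
      have "t * real (Suc j) / 2 ^ k - t * real j / 2 ^ k = h"
        by (simp add: h_def field_simps)
      then show "\<bar>t * real (Suc j) / 2 ^ k - t * real j / 2 ^ k\<bar> \<le> h"
        using h by simp
    qed (use assms in auto)
    also have "(z * (3/4) ^ k)\<^sup>2 / (2 * h powr (2 * H)) \<ge> w * (9/8) ^ k"
    proof -
      \<comment> \<open>As \<open>2 * H >= 1\<close>, halving the mesh at least halves the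
        variance.\<close>
      have "(2::real) ^ k \<le> (2 ^ k) powr (2 * H)"
        using powr_mono[of 1 "2 * H" "2 ^ k :: real"] H by simp
      then have "t powr (2 * H) / (2 ^ k) powr (2 * H) \<le> t powr (2 * H) / 2 ^ k"
        by (intro divide_left_mono) auto
      then have "h powr (2 * H) \<le> t powr (2 * H) / 2 ^ k"
        using \<open>t > 0\<close> by (simp add: h_def powr_divide)
      then have "(z * (3/4) ^ k)\<^sup>2 / (2 * (t powr (2 * H) / 2 ^ k)) \<le> (z * (3/4) ^ k)\<^sup>2 / (2 * h powr (2 * H))"
        using h \<open>t > 0\<close> by (intro divide_left_mono) auto
      moreover have "(z * (3/4) ^ k)\<^sup>2 / (2 * (t powr (2 * H) / 2 ^ k)) = w * (9/8) ^ k"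
      proof -
        have "((3/4) ^ k)\<^sup>2 * 2 ^ k = ((9/8) ^ k :: real)"
          by (simp add: power2_eq_square flip: power_mult_distrib)
        then show ?thesis
          unfolding w by (simp add: power_mult_distrib)
      qed
      ultimately show ?thesis by simp
    qed
    then have "exp (- (z * (3/4) ^ k)\<^sup>2 / (2 * h powr (2 * H))) \<le> exp (- (w * (1 + real k / 8)))"
    proof -
      assume le: "w * (9/8) ^ k \<le> (z * (3/4) ^ k)\<^sup>2 / (2 * h powr (2 * H))"
      \<comment> \<open>Bernoulli makes the exponent linear in \<open>k\<close>, so each level
        contributes one more factor \<open>exp (- w / 8)\<close>.\<close>
      have "1 + real k / 8 \<le> (9/8 :: real) ^ k"
        using Bernoulli_inequality[of "1/8 :: real" k] by simp
      moreover have "w \<ge> 0" unfolding w by simp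
      ultimately have "w * (1 + real k / 8) \<le> w * (9/8) ^ k"
        by (intro mult_left_mono)
      with le show ?thesis by simp
    qed
    finally show ?thesis by simp
  qed
  have "prob (\<Union>j<2^k. ?E j) \<le> (\<Sum>j<2^k. prob (?E j))"
  proof (intro finite_measure_subadditive_finite image_subsetI)
    fix j
    have [measurable]: "B (t * real (Suc j) / 2 ^ k) \<in> borel_measurable M"
        "B (t * real j / 2 ^ k) \<in> borel_measurable M"
      using \<open>t > 0\<close> by (auto intro!: B_measurable)
    show "?E j \<in> events" by measurable
  qed simp
  also have "\<dots> \<le> (\<Sum>j<(2::nat)^k. 2 * exp (- (w * (1 + real k / 8))))"
    by (intro sum_mono E_le)
  also have "\<dots> = 2 * exp (- w) * (2 * exp (- w / 8)) ^ k"
  proof -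
    have "exp (- (w * (1 + real k / 8))) = exp (- w) * exp (- w / 8) ^ k"
      by (simp add: algebra_simps flip: exp_add exp_of_nat_mult)
    then show ?thesis
      by (simp add: power_mult_distrib)
  qed
  also have "\<dots> \<le> 2 * exp (- w) * (1/2) ^ k"
  proof -
    \<comment> \<open>The threshold \<open>8 * ln 4\<close> is chosen so that this factor is at most
      1/4; with the 2 from doubling the number of cells the ratio becomes 1/2.\<close>
    have "exp (- w / 8) \<le> exp (- ln 4)"
      using large by simp
    also have "\<dots> = (1/4 :: real)" by (simp add: exp_minus)
    finally show ?thesis
      by (intro mult_left_mono power_mono) auto
  qed
  finally show ?thesis .
qed

text \<open>If no increment of any level is too large, a drawdown above \<open>x\<close> forces some
  increment between points of the level \<open>m\<close> grid above \<open>y / \<sigma>\<close>: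
  \<open>y\<close> is \<open>x\<close> less the chaining errors at both ends and the largest
  possible drift. The factor \<open>(2 ^ m + 1)\<^sup>2\<close> counts pairs of grid points, and the
  second term bounds the probability of an oversized increment.\<close>

lemma drawdown_tail_le:
  assumes "t > 0" "\<sigma> > 0" "x \<ge> 0" "y \<ge> 0"
    and A: "A = 1 / (2 * \<sigma>\<^sup>2 * t powr (2 * H))"
    and large: "A * x\<^sup>2 \<ge> 8 * ln 4"
    and y: "y = x * (1 - 6 * (3/4) ^ m) - \<bar>\<mu>\<bar> * t"
  shows "prob {\<omega> \<in> space M. max_drawdown (fbm_with_drift \<mu> \<sigma> B) t \<omega> > x}
    \<le> (2 ^ m + 1)\<^sup>2 * exp (- (A * y\<^sup>2)) + 4 * exp (- (A * x\<^sup>2))"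
proof -
  let ?g = "\<lambda>k j. t * real j / 2 ^ k"
  \<comment> \<open>Pairs in either order are covered, since chaining does not relate the two grid
    points it returns.\<close>
  define G where "G = (\<lambda>(i, j). {\<omega> \<in> space M. B (?g m i) \<omega> - B (?g m j) \<omega> > y / \<sigma>})"
  define E where "E k = (\<Union>j<2^k. {\<omega> \<in> space M.
    \<bar>B (?g k (Suc j)) \<omega> - B (?g k j) \<omega>\<bar> > x / \<sigma> * (3/4) ^ k})" for k
  have [measurable]: "B (?g k j) \<in> borel_measurable M" for k j
    using \<open>t > 0\<close> by (intro B_measurable) auto
  have G_ev: "G ij \<in> events" for ij
    unfolding G_def by (cases ij) simp
  have E_ev: "E k \<in> events" for k
    unfolding E_def by measurable
  have sub: "{\<omega> \<in> space M. max_drawdown (fbm_with_drift \<mu> \<sigma> B) t \<omega> > x}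
      \<subseteq> (\<Union>ij\<in>{..2^m} \<times> {..2^m}. G ij) \<union> (\<Union>k. E k)"
  proof
    fix \<omega> assume "\<omega> \<in> {\<omega> \<in> space M. max_drawdown (fbm_with_drift \<mu> \<sigma> B) t \<omega> > x}"
    then have \<omega>: "\<omega> \<in> space M" and "max_drawdown (fbm_with_drift \<mu> \<sigma> B) t \<omega> > x" by auto
    then obtain u v where uv: "0 \<le> u" "u \<le> v" "v \<le> t"
      and gt: "fbm_with_drift \<mu> \<sigma> B u \<omega> - fbm_with_drift \<mu> \<sigma> B v \<omega> > x"
      using max_drawdown_gt_iff[of t "fbm_with_drift \<mu> \<sigma> B" \<omega> x] drift_continuous[OF \<omega>] \<open>t > 0\<close> by (meson less_eq_real_def)
    show "\<omega> \<in> (\<Union>ij\<in>{..2^m} \<times> {..2^m}. G ij) \<union> (\<Union>k. E k)"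
    proof (cases "\<omega> \<in> (\<Union>k. E k)")
      case False
      have incr: "\<bar>B (?g k (Suc j)) \<omega> - B (?g k j) \<omega>\<bar> \<le> x / \<sigma> * (3/4) ^ k" if "j < 2 ^ k" for k j
        using False \<omega> that unfolding E_def by (force simp: not_less)
      note chain = dyadic_chaining[OF B_continuous[OF \<omega>] \<open>t > 0\<close> incr, of m]
      obtain i where i: "i \<le> 2 ^ m" "\<bar>B u \<omega> - B (?g m i) \<omega>\<bar> \<le> 3 * (x / \<sigma>) * (3/4) ^ m"
        using chain[of u] uv by auto
      obtain j where j: "j \<le> 2 ^ m" "\<bar>B v \<omega> - B (?g m j) \<omega>\<bar> \<le> 3 * (x / \<sigma>) * (3/4) ^ m"
        using chain[of v] uv by auto
      \<comment> \<open>Rounding each of \<open>u\<close> and \<open>v\<close> costs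
        \<open>3 * (x / \<sigma>) * (3/4) ^ m\<close>.\<close>
      have "B u \<omega> - B v \<omega> \<le> B (?g m i) \<omega> - B (?g m j) \<omega> + 6 * (x / \<sigma>) * (3/4) ^ m"
        using i(2) j(2) by linarith
      then have "\<sigma> * (B u \<omega> - B v \<omega>)
          \<le> \<sigma> * (B (?g m i) \<omega> - B (?g m j) \<omega> + 6 * (x / \<sigma>) * (3/4) ^ m)"
        using \<open>\<sigma> > 0\<close> by (intro mult_left_mono) auto
      also have "\<dots> = \<sigma> * (B (?g m i) \<omega> - B (?g m j) \<omega>) + 6 * x * (3/4) ^ m"
        using \<open>\<sigma> > 0\<close> by (simp add: distrib_left)
      finally have "\<sigma> * (B u \<omega> - B v \<omega>)
          \<le> \<sigma> * (B (?g m i) \<omega> - B (?g m j) \<omega>) + 6 * x * (3/4) ^ m" .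
      moreover have "x < \<mu> * (u - v) + \<sigma> * (B u \<omega> - B v \<omega>)"
        using gt by (simp add: fbm_with_drift_def algebra_simps)
      moreover have "\<mu> * (u - v) \<le> \<bar>\<mu>\<bar> * t"
      proof -
        have "\<mu> * (u - v) \<le> \<bar>\<mu>\<bar> * \<bar>u - v\<bar>"
          by (metis abs_ge_self abs_mult)
        also have "\<dots> \<le> \<bar>\<mu>\<bar> * t"
          using uv by (intro mult_left_mono) auto
        finally show ?thesis .
      qed
      ultimately have "y < \<sigma> * (B (?g m i) \<omega> - B (?g m j) \<omega>)"
        unfolding y by (simp add: algebra_simps)
      then have "y / \<sigma> < B (?g m i) \<omega> - B (?g m j) \<omega>"
        using \<open>\<sigma> > 0\<close> by (simp add: pos_divide_less_eq mult.commute)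
      then have "\<omega> \<in> G (i, j)"
        using \<omega> by (simp add: G_def)
      then show ?thesis
        using i(1) j(1) by blast
    qed simp
  qed
  have G_le: "prob (G ij) \<le> exp (- (A * y\<^sup>2))" if ij_in: "ij \<in> {..2^m} \<times> {..2^m}" for ij
  proof -
    obtain i j where ij: "ij = (i, j)" "i \<le> 2 ^ m" "j \<le> 2 ^ m"
      using ij_in by blast
    have pts: "?g m i \<in> {0..t}" "?g m j \<in> {0..t}"
      using dyadic_point_in[OF \<open>t > 0\<close>] ij(2,3) by blast+
    then have "\<bar>?g m i - ?g m j\<bar> \<le> t"
      unfolding atLeastAtMost_iff by linarith
    then have "prob {\<omega> \<in> space M. B (?g m i) \<omega> - B (?g m j) \<omega> > y / \<sigma>}
        \<le> exp (- (y / \<sigma>)\<^sup>2 / (2 * t powr (2 * H)))"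
      using pts assms(2,4) by (intro increment_tail_le) auto
    also have "(y / \<sigma>)\<^sup>2 / (2 * t powr (2 * H)) = A * y\<^sup>2"
      unfolding A by (simp add: power_divide field_simps)
    then have "- (y / \<sigma>)\<^sup>2 / (2 * t powr (2 * H)) = - (A * y\<^sup>2)" by simp
    finally show ?thesis
      by (simp add: G_def ij(1))
  qed
  \<comment> \<open>The level bound is applied with \<open>z = x / \<sigma>\<close>, for which
    \<open>w\<close> equals \<open>A * x\<^sup>2\<close>.\<close>
  have E_le: "prob (E k) \<le> 2 * exp (- (A * x\<^sup>2)) * (1/2) ^ k" for k
    unfolding E_def using assms
    by (intro level_tail_le large) (auto simp: power_divide field_simps)
  \<comment> \<open>The levels start at 0, so the powers of 1/2 sum to 2; together with the factor 2
    of the two-sided tail this yields the 4 of the conclusion.\<close>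
  have geo: "(\<lambda>k. 2 * exp (- (A * x\<^sup>2)) * (1/2 :: real) ^ k) sums (2 * exp (- (A * x\<^sup>2)) * 2)"
    using geometric_sums[of "1/2 :: real"] by (intro sums_mult) simp
  have E_summable: "summable (\<lambda>k. prob (E k))"
    by (rule summable_comparison_test'[OF sums_summable[OF geo]]) (use E_le in simp)
  have "prob {\<omega> \<in> space M. max_drawdown (fbm_with_drift \<mu> \<sigma> B) t \<omega> > x}
      \<le> prob ((\<Union>ij\<in>{..2^m} \<times> {..2^m}. G ij) \<union> (\<Union>k. E k))"
    using G_ev E_ev by (intro finite_measure_mono[OF sub] sets.Un sets.finite_UN sets.countable_UN') auto
  also have "\<dots> \<le> prob (\<Union>ij\<in>{..2^m} \<times> {..2^m}. G ij) + prob (\<Union>k. E k)"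
    using G_ev E_ev by (intro measure_Un_le sets.finite_UN sets.countable_UN') auto
  also have "prob (\<Union>ij\<in>{..2^m} \<times> {..2^m}. G ij) \<le> (\<Sum>ij\<in>{..2^m} \<times> {..2^m}. prob (G ij))"
    using G_ev by (intro finite_measure_subadditive_finite) auto
  also have "\<dots> \<le> (\<Sum>ij\<in>{..(2::nat)^m} \<times> {..(2::nat)^m}. exp (- (A * y\<^sup>2)))"
    by (intro sum_mono G_le)
  also have "\<dots> = (2 ^ m + 1)\<^sup>2 * exp (- (A * y\<^sup>2))"
    by (simp add: card_cartesian_product power2_eq_square algebra_simps)
  also have "prob (\<Union>k. E k) \<le> (\<Sum>k. prob (E k))"
    using E_ev E_summable by (intro finite_measure_subadditive_countably) auto
  also have "\<dots> \<le> 2 * exp (- (A * x\<^sup>2)) * 2"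
    using suminf_le[OF E_le E_summable sums_summable[OF geo]] sums_unique[OF geo] by simp
  finally show ?thesis by simp
qed

end

section \<open>The logarithmic limit\<close>

theorem theorem3:
  fixes M :: "'a measure" and B :: "real \<Rightarrow> 'a \<Rightarrow> real" and H \<mu> \<sigma> t :: real
  assumes "prob_space M"
    and "1/2 \<le> H" and "H < 1"
    and "standard_fbm M H B"
    and "\<sigma> > 0"
    and "t > 0"
  shows "((\<lambda>x. 1 / x\<^sup>2 * ln \<P>(\<omega> in M. max_drawdown (fbm_with_drift \<mu> \<sigma> B) t \<omega> > x))
           \<longlongrightarrow> - 1 / (2 * \<sigma>\<^sup>2 * t powr (2 * H))) at_top"
proof -
  interpret prob_space M by fact
  interpret fbm M B H
    using assms by unfold_locales auto
  define A where "A = 1 / (2 * \<sigma>\<^sup>2 * t powr (2 * H))"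
  have "A > 0" using assms by (simp add: A_def)
  define p where "p x = prob {\<omega> \<in> space M. max_drawdown (fbm_with_drift \<mu> \<sigma> B) t \<omega> > x}" for x
  \<comment> \<open>The logarithms of both tail bounds take the form
    \<open>a - A * (b * x + c)\<^sup>2\<close>; after division by \<open>x\<^sup>2\<close> only
    \<open>b\<close> matters in the limit.\<close>
  have quadratic_limit: "((\<lambda>x. 1 / x\<^sup>2 * (a - A * (b * x + c)\<^sup>2)) \<longlongrightarrow> - (A * b\<^sup>2)) at_top" for a b c :: real
  proof -
    have "((\<lambda>x::real. 1 / x) \<longlongrightarrow> 0) at_top" "((\<lambda>x::real. 1 / x\<^sup>2) \<longlongrightarrow> 0) at_top"
      by real_asymp+
    then have "((\<lambda>x. a * (1 / x\<^sup>2) - A * (b + c * (1 / x))\<^sup>2) \<longlongrightarrow> a * 0 - A * (b + c * 0)\<^sup>2) at_top"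
      by (intro tendsto_intros)
    moreover have "\<forall>\<^sub>F x in at_top. a * (1 / x\<^sup>2) - A * (b + c * (1 / x))\<^sup>2
        = 1 / x\<^sup>2 * (a - A * (b * x + c)\<^sup>2)"
      using eventually_gt_at_top[of 0]
    proof eventually_elim
      case (elim x)
      then have "b + c * (1 / x) = (b * x + c) / x" by (simp add: field_simps)
      then show ?case by (simp add: power_divide right_diff_distrib)
    qed
    ultimately show ?thesis
      by (auto intro: Lim_transform_eventually)
  qed
  define s where "s = t powr H"
  have s: "s > 0" "s\<^sup>2 = t powr (2 * H)"
    using \<open>t > 0\<close> by (auto simp: s_def power2_eq_square simp flip: powr_add)
  \<comment> \<open>Positivity of \<open>p x\<close> is recorded as well, because comparing
    logarithms in the upper bound requires it. The bound is written with \<open>b = 1\<close> to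
    match \<open>quadratic_limit\<close>.\<close>
  have lower: "\<forall>\<^sub>F x in at_top. p x > 0 \<and>
      1 / x\<^sup>2 * (- ln (sqrt (2 * pi * s\<^sup>2)) - A * (1 * x + (\<mu> * t + \<sigma>))\<^sup>2) \<le> 1 / x\<^sup>2 * ln (p x)"
    using eventually_ge_at_top[of "- (\<mu> * t)"]
  proof eventually_elim
    case (elim x)
    let ?a = "(x + \<mu> * t) / \<sigma> + 1"
    have le: "normal_density 0 s ?a \<le> p x"
      unfolding p_def s_def using elim assms by (intro drawdown_tail_ge) auto
    have pos: "normal_density 0 s ?a > 0"
      using s by (intro normal_density_pos)
    have a: "?a\<^sup>2 / (2 * s\<^sup>2) = A * (1 * x + (\<mu> * t + \<sigma>))\<^sup>2"
    proof -
      have "?a = (1 * x + (\<mu> * t + \<sigma>)) / \<sigma>"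
        using \<open>\<sigma> > 0\<close> by (simp add: field_simps)
      then show ?thesis
        unfolding A_def s(2)[symmetric] by (simp add: power_divide)
    qed
    have "ln (normal_density 0 s ?a) = - ln (sqrt (2 * pi * s\<^sup>2)) - ?a\<^sup>2 / (2 * s\<^sup>2)"
      using s(1) unfolding normal_density_def by (subst ln_mult) (auto simp: ln_div)
    then have "- ln (sqrt (2 * pi * s\<^sup>2)) - A * (1 * x + (\<mu> * t + \<sigma>))\<^sup>2 \<le> ln (p x)"
      unfolding a using le pos by (metis less_le_trans ln_le_cancel_iff)
    then show ?case
      using le pos by (intro conjI mult_left_mono) auto
  qed
  have upper: "\<forall>\<^sub>F x in at_top. 1 / x\<^sup>2 * ln (p x)
      \<le> 1 / x\<^sup>2 * (ln ((2 ^ m + 1)\<^sup>2 + 4) - A * ((1 - 6 * (3/4) ^ m) * x + - (\<bar>\<mu>\<bar> * t))\<^sup>2)"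
    if "6 * (3/4) ^ m < (1::real)" for m
  proof -
    define b where "b = 1 - 6 * (3/4 :: real) ^ m"
    have b: "0 < b" "b \<le> 1" using that by (auto simp: b_def)
    have "\<forall>\<^sub>F x in at_top. A * x\<^sup>2 \<ge> 8 * ln 4"
      using \<open>A > 0\<close> by real_asymp
    \<comment> \<open>The condition on \<open>m\<close> makes \<open>b\<close> positive, so the
      threshold \<open>y\<close> is eventually nonnegative.\<close>
    moreover have "\<forall>\<^sub>F x in at_top. x * b - \<bar>\<mu>\<bar> * t \<ge> 0"
      using b by real_asymp
    moreover have "\<forall>\<^sub>F x in at_top. p x > 0"
      using lower by eventually_elim simp
    ultimately show ?thesis
      using eventually_ge_at_top[of 0]
    proof eventually_elim
      case (elim x)
      define y where "y = x * b - \<bar>\<mu>\<bar> * t"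
      have "p x \<le> (2 ^ m + 1)\<^sup>2 * exp (- (A * y\<^sup>2)) + 4 * exp (- (A * x\<^sup>2))"
        unfolding p_def using elim assms
        by (intro drawdown_tail_le[where \<mu> = \<mu>, OF _ _ _ _ A_def]) (auto simp: y_def b_def)
      \<comment> \<open>With \<open>0 <= y <= x\<close> the term for oversized increments is
        absorbed into the main one, which leaves a single exponential to take the logarithm
        of.\<close>
      also have "y \<le> x"
      proof -
        have "x * b \<le> x" using b elim by (simp add: mult_left_le)
        then show ?thesis unfolding y_def using \<open>t > 0\<close>
          by (smt (verit) abs_ge_zero mult_nonneg_nonneg)
      qed
      then have "exp (- (A * x\<^sup>2)) \<le> exp (- (A * y\<^sup>2))"
        using elim \<open>A > 0\<close> by (simp add: y_def mult_left_mono power_mono)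
      finally have "p x \<le> ((2 ^ m + 1)\<^sup>2 + 4) * exp (- (A * y\<^sup>2))"
        by (simp add: algebra_simps)
      then have "ln (p x) \<le> ln (((2 ^ m + 1)\<^sup>2 + 4) * exp (- (A * y\<^sup>2)))"
        using elim by (subst ln_le_cancel_iff) (auto intro: less_le_trans)
      also have "\<dots> = ln ((2 ^ m + 1)\<^sup>2 + 4) - A * y\<^sup>2"
        by (subst ln_mult) (simp_all add: add_nonneg_eq_0_iff)
      also have "y = b * x + - (\<bar>\<mu>\<bar> * t)"
        by (simp add: y_def)
      finally show ?case
        unfolding b_def by (intro mult_left_mono) auto
    qed
  qed
  have "((\<lambda>x. 1 / x\<^sup>2 * ln (p x)) \<longlongrightarrow> - A) at_top"
  proof (rule order_tendstoI)
    fix l assume "l < - A"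
    then have "\<forall>\<^sub>F x in at_top. l < 1 / x\<^sup>2 * (- ln (sqrt (2 * pi * s\<^sup>2)) - A * (1 * x + (\<mu> * t + \<sigma>))\<^sup>2)"
      by (intro order_tendstoD(1)[OF quadratic_limit]) simp
    with lower show "\<forall>\<^sub>F x in at_top. l < 1 / x\<^sup>2 * ln (p x)"
      by eventually_elim linarith
  next
    fix l assume l: "- A < l"
    \<comment> \<open>First \<open>m\<close> is fixed, large enough that the limit of the upper
      bound lies below \<open>l\<close>; only then does \<open>x\<close> tend to infinity. The bound
      is not uniform in \<open>m\<close>, as its prefactor grows with the grid.\<close>
    have "(\<lambda>m. - (A * (1 - 6 * (3/4 :: real) ^ m)\<^sup>2)) \<longlonglongrightarrow> - A"
      by real_asymp
    from order_tendstoD(2)[OF this l]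
    have "\<forall>\<^sub>F m in sequentially. - (A * (1 - 6 * (3/4 :: real) ^ m)\<^sup>2) < l" .
    moreover have "\<forall>\<^sub>F m in sequentially. 6 * (3/4) ^ m < (1::real)"
      by real_asymp
    ultimately have "\<exists>m. - (A * (1 - 6 * (3/4 :: real) ^ m)\<^sup>2) < l \<and> 6 * (3/4) ^ m < (1::real)"
      by (intro eventually_happens'[OF sequentially_bot] eventually_conj)
    then obtain m where m: "- (A * (1 - 6 * (3/4 :: real) ^ m)\<^sup>2) < l" "6 * (3/4) ^ m < (1::real)"
      by blast
    from upper[OF m(2)] order_tendstoD(2)[OF quadratic_limit m(1)]
    show "\<forall>\<^sub>F x in at_top. 1 / x\<^sup>2 * ln (p x) < l"
      by eventually_elim (rule le_less_trans)
  qed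
  then show ?thesis
    unfolding p_def A_def by simp
qed

end
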